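(* Let $n,k\ge 0$ be integers. The number of partitions $\lambda$ with $\lambda_1\le k$ and $i_{2n}(\lambda)<\infty$ equals $2^k\binom{n+k}{k}$. Equivalently, the total homology $\bigoplus_i \mathrm{H}_i(\mathfrak{H}_V(E);\mathbf{C})$, for $\dim V=2n$ and $\dim E=k$, decomposes as a direct sum of exactly $2^k\binom{n+k}{k}$ irreducible $\mathbf{GL}(E)\times\mathbf{Sp}(V)$-modules, pairwise non-isomorphic.
   Context: Partitions, $\lambda_1$ (the largest part), $\ell(\lambda)$, $|\lambda|$, $\lambda^\dagger$ as usual. Modification rule (defines $i_{2n}(\lambda)\in\mathbf{Z}_{\ge0}\cup\{\infty\}$ and $\tau_{2n}(\lambda)$), recursively: if $\ell(\lambda)\le n$, put $i_{2n}(\lambda)=0$, $\tau_{2n}(\lambda)=\lambda$. If $\ell(\lambda)>n$, let $R_\lambda$ be the border strip (connected skew diagram with no $2\times 2$ square) of $2(\ell(\lambda)-n-1)$ boxes along the rim of $\lambda$ starting at the first box of the last row of $\lambda$, if it exists. If $R_\lambda$ exists, is nonempty, and $\lambda\setminus R_\lambda$ is a partition, then $i_{2n}(\lambda)=c(R_\lambda)+i_{2n}(\lambda\setminus R_\lambda)$ and $\tau_{2n}(\lambda)=\tau_{2n}(\lambda\setminus R_\lambda)$ with $c(R_\lambda)$ the number of columns of $R_\lambda$; otherwise $i_{2n}(\lambda)=\infty$. The Lie algebra $\mathfrak{H}_V(E)=(E\otimes V)\oplus\mathrm{Sym}^2(E)$ for symplectic $(V,\omega_V)$ has bracket $[(e\otimes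 v,x),(e'\otimes v',x')]=(0,\omega_V(v,v')ee')$. *)

theory Defs
  imports Main
begin

definition is_partition :: "nat list \<Rightarrow> bool" where
  "is_partition lam \<longleftrightarrow> sorted_wrt (\<ge>) lam \<and> 0 \<notin> set lam"

definition largest_part :: "nat list \<Rightarrow> nat" where
  "largest_part lam = (if lam = [] then 0 else hd lam)"

text \<open>Young diagram, boxes (row i, column j), 1-based (English convention).\<close>
definition diagram :: "nat list \<Rightarrow> (nat \<times> nat) set" where
  "diagram lam = {(i, j). 1 \<le> i \<and> i \<le> length lam \<and> 1 \<le> j \<and> j \<le> lam ! (i - 1)}"

text \<open>There is exactly one rim box on each diagonal of content j - i between
  1 - length lam and largest_part lam - 1; ordered by content, the rim runs from the
  first box of the last row to the last box of the first row.\<close>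
definition rim :: "nat list \<Rightarrow> (nat \<times> nat) set" where
  "rim lam = {(i, j). (i, j) \<in> diagram lam \<and> (i + 1, j + 1) \<notin> diagram lam}"

definition strip_size :: "nat \<Rightarrow> nat list \<Rightarrow> nat" where
  "strip_size n lam = 2 * (length lam - n - 1)"

text \<open>R_lambda: the first strip_size n lam boxes of the rim, starting at the first box
  (ell,1) of the last row, i.e. the rim boxes of content at most
  strip_size n lam - ell(lambda).  It exists iff strip_size n lam \<le> number of rim boxes
  = ell(lambda) + lambda_1 - 1.\<close>
definition border_strip :: "nat \<Rightarrow> nat list \<Rightarrow> (nat \<times> nat) set" where
  "border_strip n lam = {(i, j). (i, j) \<in> rim lam \<and>
      int j - int i \<le> int (strip_size n lam) - int (length lam)}"

definition border_strip_exists :: "nat \<Rightarrow> nat list \<Rightarrow> bool" where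
  "border_strip_exists n lam \<longleftrightarrow> strip_size n lam + 1 \<le> length lam + largest_part lam"

definition num_columns :: "(nat \<times> nat) set \<Rightarrow> nat" where
  "num_columns R = card (snd ` R)"

text \<open>The modification rule, as a relation: mod_rule n lam i tau holds iff
  i_{2n}(lam) = i (finite) and tau_{2n}(lam) = tau.  If no such i exists,
  i_{2n}(lam) = infinity.  (The rule is deterministic, so i and tau are unique.)\<close>
inductive mod_rule :: "nat \<Rightarrow> nat list \<Rightarrow> nat \<Rightarrow> nat list \<Rightarrow> bool" where
  base: "length lam \<le> n \<Longrightarrow> mod_rule n lam 0 lam"
| step: "\<lbrakk> n < length lam;
           border_strip_exists n lam;
           0 < strip_size n lam;
           is_partition mu;
           diagram mu = diagram lam - border_strip n lam;
           mod_rule n mu i tau \<rbrakk>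
         \<Longrightarrow> mod_rule n lam (num_columns (border_strip n lam) + i) tau"

definition i2n_finite :: "nat \<Rightarrow> nat list \<Rightarrow> bool" where
  "i2n_finite n lam \<longleftrightarrow> (\<exists>i tau. mod_rule n lam i tau)"

end

theory Submission
  imports Defs
begin

text \<open>Encode a partition \<open>\<lambda>\<close> by its shifted beta set
  \<open>M(\<lambda>) = {\<lambda>\<^sub>i - i + n + 1 : i \<ge> 1}\<close> (with \<open>\<lambda>\<^sub>i = 0\<close> for \<open>i > \<ell>(\<lambda>)\<close>). The strip \<open>R\<^sub>\<lambda>\<close> can be
  removed leaving a partition exactly when \<open>t = \<ell>(\<lambda>) - n - 1\<close> lies in \<open>M(\<lambda>)\<close>, and the removal
  replaces \<open>t\<close> by \<open>-t\<close>, which is never in \<open>M(\<lambda>)\<close>. Hence \<open>i\<^sub>2\<^sub>n(\<lambda>) < \<infinity>\<close> iff \<open>0 \<in> M(\<lambda>)\<close> and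
  for every \<open>y > 0\<close> one of \<open>y, -y\<close> lies in \<open>M(\<lambda>)\<close>.

  If moreover \<open>\<lambda>\<^sub>1 \<le> k\<close>, then \<open>\<lambda>\<close> has at most \<open>L = 2n + k + 1\<close> rows, and \<open>\<lambda>\<close> is determined by its
  \<open>L\<close> beta numbers \<open>\<lambda>\<^sub>i + L - i\<close>, which form an arbitrary \<open>L\<close>-subset \<open>B\<close> of \<open>{0..2N}\<close>, \<open>N = n + k\<close>.
  The condition becomes: \<open>N \<in> B\<close> and \<open>N + y \<in> B\<close> or \<open>N - y \<in> B\<close> for \<open>1 \<le> y \<le> N\<close>. Such a \<open>B\<close>
  is given by the set \<open>D\<close> of those \<open>y\<close> with both \<open>N \<pm> y \<in> B\<close>, which has \<open>n\<close> elements, and an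
  arbitrary subset of the remaining \<open>k\<close> values \<open>y\<close> with \<open>N + y \<in> B\<close>; this gives
  \<open>(N choose n) * 2 ^ k\<close> sets.\<close>

section \<open>Partitions as antitone functions\<close>

definition part :: "nat list \<Rightarrow> nat \<Rightarrow> nat" where
  "part lam i = (if i < length lam then lam ! i else 0)"

definition diagram_fun :: "(nat \<Rightarrow> nat) \<Rightarrow> (nat \<times> nat) set" where
  "diagram_fun f = {(i, j). 1 \<le> i \<and> 1 \<le> j \<and> j \<le> f (i - 1)}"

definition partition_of_fun :: "(nat \<Rightarrow> nat) \<Rightarrow> nat list" where
  "partition_of_fun f = map f [0..<(LEAST i. f i = 0)]"

lemma part_antimono:
  assumes "is_partition lam" "i \<le> j"
  shows "part lam j \<le> part lam i"
proof (cases "i < j \<and> j < length lam")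
  case True
  with assms(1) show ?thesis by (auto simp: part_def is_partition_def sorted_wrt_iff_nth_less)
next
  case False
  with assms(2) show ?thesis by (auto simp: part_def)
qed

lemma part_pos_iff:
  assumes "is_partition lam"
  shows "0 < part lam i \<longleftrightarrow> i < length lam"
  using assms by (auto simp: part_def is_partition_def) (metis nth_mem neq0_conv)

lemma largest_part_eq_part_0: "is_partition lam \<Longrightarrow> largest_part lam = part lam 0"
  by (cases lam) (auto simp: largest_part_def part_def)

lemma part_inj:
  assumes "is_partition lam" "is_partition mu" "part lam = part mu"
  shows "lam = mu"
proof -
  have "i < length lam \<longleftrightarrow> i < length mu" for i
    using part_pos_iff[OF assms(1)] part_pos_iff[OF assms(2)] assms(3) by metis
  then have len: "length lam = length mu" by (metis less_irrefl nat_neq_iff)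
  moreover have "lam ! i = mu ! i" if "i < length lam" for i
    using assms(3) len that by (metis part_def)
  ultimately show ?thesis by (simp add: list_eq_iff_nth_eq)
qed

lemma diagram_eq_diagram_fun: "diagram lam = diagram_fun (part lam)"
  by (auto simp: diagram_def diagram_fun_def part_def split: if_splits)

lemma mem_diagram_iff: "(i, j) \<in> diagram lam \<longleftrightarrow> 1 \<le> i \<and> 1 \<le> j \<and> j \<le> part lam (i - 1)"
  by (simp add: diagram_eq_diagram_fun diagram_fun_def)

lemma diagram_fun_inject: "diagram_fun f = diagram_fun g \<Longrightarrow> f = g"
proof
  fix i
  assume eq: "diagram_fun f = diagram_fun g"
  have "j \<le> f i \<longleftrightarrow> j \<le> g i" if "1 \<le> j" for j
  proof -
    have "(Suc i, j) \<in> diagram_fun f \<longleftrightarrow> (Suc i, j) \<in> diagram_fun g" using eq by simp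
    with that show ?thesis by (simp add: diagram_fun_def)
  qed
  from this[of "f i"] this[of "g i"] show "f i = g i"
    by (cases "f i = 0"; cases "g i = 0") auto
qed

lemma partition_of_fun:
  assumes antimono: "\<And>i j. i \<le> j \<Longrightarrow> f j \<le> f i" and zero: "f m = 0"
  shows "is_partition (partition_of_fun f)" "part (partition_of_fun f) = f"
    "length (partition_of_fun f) \<le> m"
proof -
  define l where "l = (LEAST i. f i = 0)"
  have "f l = 0" unfolding l_def by (rule LeastI[of _ m]) (rule zero)
  then have ge: "l \<le> i \<Longrightarrow> f i = 0" for i using antimono[of l i] by simp
  have lt: "i < l \<Longrightarrow> f i \<noteq> 0" for i unfolding l_def using not_less_Least by blast
  have def: "partition_of_fun f = map f [0..<l]" by (simp add: partition_of_fun_def l_def)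
  show "is_partition (partition_of_fun f)" unfolding def is_partition_def
    by (auto simp: sorted_wrt_iff_nth_less antimono lt)
  show "part (partition_of_fun f) = f" by (rule ext) (auto simp: def part_def ge)
  show "length (partition_of_fun f) \<le> m"
    unfolding def l_def using Least_le[of "\<lambda>i. f i = 0" m, OF zero] by simp
qed

section \<open>Beta numbers\<close>

definition beta :: "nat \<Rightarrow> (nat \<Rightarrow> nat) \<Rightarrow> nat \<Rightarrow> int" where
  "beta n f i = int (f i) - int i + int n"

definition beta_set :: "nat \<Rightarrow> nat list \<Rightarrow> int set" where
  "beta_set n lam = range (beta n (part lam))"

abbreviation strip_label :: "nat \<Rightarrow> nat list \<Rightarrow> int" where
  "strip_label n lam \<equiv> int (length lam) - int n - 1"

lemma beta_strict_antimono:
  assumes "is_partition lam" "i < j"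
  shows "beta n (part lam) j < beta n (part lam) i"
  using part_antimono[OF assms(1), of i j] assms(2) unfolding beta_def by linarith

lemma inj_beta: "is_partition lam \<Longrightarrow> inj (beta n (part lam))"
  by (metis beta_strict_antimono injI less_irrefl nat_neq_iff)

lemma neg_strip_label_notin_beta_set:
  assumes "is_partition lam"
  shows "- strip_label n lam \<notin> beta_set n lam"
proof
  assume "- strip_label n lam \<in> beta_set n lam"
  then obtain i where i: "int (part lam i) - int i + int n = - strip_label n lam"
    unfolding beta_set_def beta_def by auto
  show False
  proof (cases "i < length lam")
    case True
    then have "0 < part lam i" using part_pos_iff[OF assms] by blast
    with i True show False by linarith
  qed (use i in \<open>simp add: part_def\<close>)
qed

section \<open>Removing the border strip\<close>

text \<open>Removing a border strip whose last box ends row \<open>r + 1\<close>: the rows above are kept, and each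
  row below moves up by one and loses one box.\<close>

definition strip_removal :: "nat list \<Rightarrow> nat \<Rightarrow> nat \<Rightarrow> nat" where
  "strip_removal lam r i = (if i < r then part lam i else part lam (i + 1) - 1)"

lemma strip_size_int: "n < length lam \<Longrightarrow> int (strip_size n lam) = 2 * int (length lam) - 2 * int n - 2"
  by (simp add: strip_size_def)

lemma mem_border_strip_iff:
  "(i, j) \<in> border_strip n lam \<longleftrightarrow> 1 \<le> i \<and> 1 \<le> j \<and> j \<le> part lam (i - 1) \<and> part lam i \<le> j
     \<and> int j - int i \<le> int (strip_size n lam) - int (length lam)"
  by (auto simp: border_strip_def rim_def mem_diagram_iff)

lemma diagram_minus_border_strip:
  assumes P: "is_partition lam" and long: "n < length lam"
    and r: "beta n (part lam) r = strip_label n lam"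
  shows "diagram lam - border_strip n lam = diagram_fun (strip_removal lam r)"
proof -
  define c where "c = int (strip_size n lam) - int (length lam)"
  have q: "int (part lam r) - int r - 1 = c" using r strip_size_int[OF long] unfolding c_def beta_def by linarith
  have "(Suc i, j) \<in> diagram lam - border_strip n lam \<longleftrightarrow> (Suc i, j) \<in> diagram_fun (strip_removal lam r)"
    if "1 \<le> j" for i j
  proof (cases "i < r")
    case True
    have "part lam r \<le> part lam (Suc i)" using part_antimono[OF P, of "Suc i" r] True by simp
    then have "part lam (Suc i) \<le> j \<Longrightarrow> \<not> int j - int (Suc i) \<le> c" using q True by linarith
    then show ?thesis using True that
      by (auto simp: mem_diagram_iff mem_border_strip_iff diagram_fun_def strip_removal_def c_def)
  next
    case False
    have "part lam i \<le> part lam r" "part lam (Suc i) \<le> part lam i"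
      using part_antimono[OF P, of r i] part_antimono[OF P, of i "Suc i"] False by simp_all
    moreover have "j \<le> part lam i \<Longrightarrow> int j - int (Suc i) \<le> c" using q False calculation by linarith
    ultimately show ?thesis using False that
      by (auto simp: mem_diagram_iff mem_border_strip_iff diagram_fun_def strip_removal_def c_def)
  qed
  moreover have "(i, j) \<notin> diagram lam" "(i, j) \<notin> diagram_fun f" if "i = 0 \<or> j = 0" for i j f
    using that by (auto simp: mem_diagram_iff diagram_fun_def)
  ultimately show ?thesis by (auto simp: set_eq_iff) (metis not0_implies_Suc Suc_leI neq0_conv)+
qed

lemma border_strip_removable_imp_beta:
  assumes P: "is_partition lam" and long: "n < length lam" and pos: "0 < strip_size n lam"
    and ex: "border_strip_exists n lam"
    and eq: "diagram lam - border_strip n lam = diagram_fun g"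
  shows "\<exists>r. beta n (part lam) r = strip_label n lam"
proof (rule ccontr)
  assume no: "\<not> ?thesis"
  define c where "c = int (strip_size n lam) - int (length lam)"
  define q where "q r = int (part lam r) - int r - 1" for r
  have nq: "q r \<noteq> c" for r
  proof
    assume "q r = c"
    then have "beta n (part lam) r = strip_label n lam"
      using strip_size_int[OF long] unfolding q_def c_def beta_def by linarith
    with no show False by blast
  qed
  have "c \<le> q 0" using ex largest_part_eq_part_0[OF P] unfolding border_strip_exists_def c_def q_def by simp
  have c1: "1 - int (length lam) \<le> c" using pos unfolding c_def by simp
  then have "q (length lam) < c" unfolding q_def by (simp add: part_def)
  define r0 where "r0 = (LEAST r. q r < c)"
  have r0: "q r0 < c" unfolding r0_def by (rule LeastI[of _ "length lam"]) fact
  have "r0 \<noteq> 0" using r0 \<open>c \<le> q 0\<close> by (metis not_less)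
  then obtain r where r: "r0 = Suc r" by (cases r0) auto
  have qr: "c < q r" using not_less_Least[of r "\<lambda>r. q r < c"] nq[of r] r unfolding r0_def by force
  have qr1: "q (Suc r) < c" using r0 r by simp
  have cr: "- int r \<le> c"
  proof (cases "Suc r < length lam")
    case True
    then have "0 < part lam (Suc r)" using part_pos_iff[OF P] by blast
    then show ?thesis using qr1 unfolding q_def by linarith
  qed (use c1 in linarith)
  txt \<open>The strip ends at the box \<open>(r + 1, j)\<close> strictly inside row \<open>r + 1\<close>, so the box to its
    right survives the removal although \<open>(r + 1, j)\<close> does not.\<close>
  define j where "j = nat (c + int r + 1)"
  have j: "int j = c + int r + 1" unfolding j_def using cr by simp
  have removed: "(Suc r, j) \<in> border_strip n lam" and "(Suc r, Suc j) \<in> diagram lam"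
    "(Suc r, Suc j) \<notin> border_strip n lam"
    using j qr qr1 cr unfolding mem_border_strip_iff mem_diagram_iff q_def c_def by auto
  then have "(Suc r, Suc j) \<in> diagram_fun g" using eq by blast
  then have "Suc j \<le> g r" by (simp add: diagram_fun_def)
  then have "(Suc r, j) \<in> diagram_fun g" using j cr by (auto simp: diagram_fun_def)
  with eq removed show False by auto
qed

lemma beta_strip_removal:
  assumes P: "is_partition lam" and r: "r < length lam"
  shows "beta n (strip_removal lam r) i =
    (if i < r then beta n (part lam) i
     else if Suc i < length lam then beta n (part lam) (Suc i)
     else if Suc i = length lam then - strip_label n lam
     else beta n (part lam) i)"
proof -
  have "0 < part lam (Suc i)" if "Suc i < length lam" using that part_pos_iff[OF P] by blast
  moreover have "part lam i = 0" "part lam (Suc i) = 0" if "length lam \<le> i"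
    using that by (simp_all add: part_def)
  ultimately show ?thesis using r
    by (auto simp: beta_def strip_removal_def part_def[of lam "Suc i"] of_nat_diff)
qed

lemma beta_set_strip_removal:
  assumes P: "is_partition lam" and r: "r < length lam" and mu: "part mu = strip_removal lam r"
  shows "beta_set n mu =
    insert (- strip_label n lam) (beta_set n lam - {beta n (part lam) r})"
proof -
  let ?v = "beta n (part lam)" and ?a = "- strip_label n lam"
  note g = beta_strip_removal[OF P r, of n]
  have "range (beta n (strip_removal lam r)) = insert ?a (?v ` (UNIV - {r}))"
  proof (intro equalityI subsetI)
    fix x assume "x \<in> range (beta n (strip_removal lam r))"
    then obtain i where "x = beta n (strip_removal lam r) i" by blast
    then show "x \<in> insert ?a (?v ` (UNIV - {r}))"
      using r unfolding g by (auto split: if_splits)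
  next
    fix x assume "x \<in> insert ?a (?v ` (UNIV - {r}))"
    then consider "x = ?a" | j where "x = ?v j" "j \<noteq> r" by blast
    then show "x \<in> range (beta n (strip_removal lam r))"
    proof cases
      case 1
      then have "x = beta n (strip_removal lam r) (length lam - 1)" using r unfolding g by auto
      then show ?thesis by simp
    next
      case (2 j)
      show ?thesis
      proof (cases "r < j \<and> j < length lam")
        case True
        then obtain i where "j = Suc i" "r \<le> i" by (cases j) auto
        then have "x = beta n (strip_removal lam r) i" using True 2 unfolding g by auto
        then show ?thesis by simp
      next
        case False
        then have "x = beta n (strip_removal lam r) j" using 2 r unfolding g by auto
        then show ?thesis by simp
      qed
    qed
  qed
  then show ?thesis
    using inj_beta[OF P] by (simp add: beta_set_def mu image_set_diff)
qed

section \<open>Admissible beta sets\<close>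

definition admissible :: "int set \<Rightarrow> bool" where
  "admissible M \<longleftrightarrow> 0 \<in> M \<and> (\<forall>y>0. y \<in> M \<or> - y \<in> M)"

lemma admissible_swap:
  assumes "0 < t" "t \<in> M"
  shows "admissible (insert (- t) (M - {t})) \<longleftrightarrow> admissible M"
proof -
  have "y \<in> insert (- t) (M - {t}) \<or> - y \<in> insert (- t) (M - {t}) \<longleftrightarrow> y \<in> M \<or> - y \<in> M"
    if "0 < y" for y
    using assms that by (cases "y = t") auto
  moreover have "0 \<in> insert (- t) (M - {t}) \<longleftrightarrow> 0 \<in> M" using assms(1) by auto
  ultimately show ?thesis unfolding admissible_def by blast
qed

lemma admissible_beta_set_short:
  assumes "length lam \<le> n"
  shows "admissible (beta_set n lam)"
proof -
  have "int n - int i \<in> beta_set n lam" if "n \<le> i" for i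
    using assms that unfolding beta_set_def beta_def part_def
    by (intro image_eqI[of _ _ i]) auto
  moreover have "- y = int n - int (n + nat y)" if "0 < y" for y using that by simp
  ultimately show ?thesis unfolding admissible_def by (metis diff_self le_add1 order_refl)
qed

lemma row_of_strip_label:
  assumes "n < length lam" "beta n (part lam) r = strip_label n lam"
  shows "r < length lam"
  using assms by (cases "r < length lam") (auto simp: beta_def part_def)

lemma border_strip_exists_if_strip_label:
  assumes P: "is_partition lam" and long: "n < length lam"
    and r: "beta n (part lam) r = strip_label n lam"
  shows "border_strip_exists n lam"
  using part_antimono[OF P, of 0 r] r strip_size_int[OF long] largest_part_eq_part_0[OF P]
  unfolding border_strip_exists_def beta_def by linarith

lemma exists_partition_strip_removal:
  assumes P: "is_partition lam" and r: "r < length lam"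
  obtains mu where "is_partition mu" "part mu = strip_removal lam r" "length mu < length lam"
proof -
  have antimono: "strip_removal lam r j \<le> strip_removal lam r i" if "i \<le> j" for i j
    using that part_antimono[OF P, of i j] part_antimono[OF P, of i "Suc j"]
      part_antimono[OF P, of "Suc i" "Suc j"]
    unfolding strip_removal_def by (simp split: if_split; linarith)
  have zero: "strip_removal lam r (length lam - 1) = 0"
    using r by (simp add: strip_removal_def part_def)
  note mu = partition_of_fun[of "strip_removal lam r", OF antimono zero]
  have "length (partition_of_fun (strip_removal lam r)) < length lam"
    using mu(3) r by linarith
  with mu(1,2) show ?thesis by (rule that)
qed

lemma admissible_strip_removal_iff:
  assumes P: "is_partition lam" and pos: "0 < strip_size n lam"
    and r: "beta n (part lam) r = strip_label n lam"
    and mu: "part mu = strip_removal lam r"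
  shows "admissible (beta_set n mu) \<longleftrightarrow> admissible (beta_set n lam)"
proof -
  have long: "n + 1 < length lam" using pos by (simp add: strip_size_def)
  have eq: "beta_set n mu = insert (- strip_label n lam) (beta_set n lam - {strip_label n lam})"
    using beta_set_strip_removal[OF P row_of_strip_label[OF _ r] mu, where n=n] long
    unfolding r by simp
  have mem: "strip_label n lam \<in> beta_set n lam"
    unfolding beta_set_def r[symmetric] by (rule rangeI)
  have "0 < strip_label n lam" using long by simp
  from admissible_swap[OF this mem] show ?thesis unfolding eq .
qed

lemma mod_rule_imp_admissible:
  "mod_rule n lam i tau \<Longrightarrow> is_partition lam \<Longrightarrow> admissible (beta_set n lam)"
proof (induction rule: mod_rule.induct)
  case (base lam n)
  from base.hyps show ?case by (rule admissible_beta_set_short)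
next
  case (step n lam mu i tau)
  have P: "is_partition lam" by fact
  have dg: "diagram lam - border_strip n lam = diagram_fun (part mu)"
    using step.hyps(5) diagram_eq_diagram_fun by metis
  obtain r where r: "beta n (part lam) r = strip_label n lam"
    using border_strip_removable_imp_beta[OF P step.hyps(1,3,2) dg] by blast
  have "part mu = strip_removal lam r"
    using dg diagram_minus_border_strip[OF P step.hyps(1) r] by (metis diagram_fun_inject)
  with step show ?case using admissible_strip_removal_iff[OF P step.hyps(3) r] by blast
qed

lemma admissible_imp_i2n_finite:
  "is_partition lam \<Longrightarrow> admissible (beta_set n lam) \<Longrightarrow> i2n_finite n lam"
proof (induction "length lam" arbitrary: lam rule: less_induct)
  case less
  note P = less.prems(1)
  show ?case
  proof (cases "length lam \<le> n")
    case True
    then show ?thesis unfolding i2n_finite_def using mod_rule.base by blast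
  next
    case False
    then have long: "n < length lam" by simp
    have gap: "- strip_label n lam \<notin> beta_set n lam" by (rule neg_strip_label_notin_beta_set[OF P])
    with less.prems(2) long have "0 < strip_label n lam"
      unfolding admissible_def by (cases "int (length lam) = int n + 1") auto
    with less.prems(2) gap have "strip_label n lam \<in> beta_set n lam" unfolding admissible_def by blast
    then obtain r where r: "beta n (part lam) r = strip_label n lam" unfolding beta_set_def by auto
    have pos: "0 < strip_size n lam" using \<open>0 < strip_label n lam\<close> unfolding strip_size_def by simp
    obtain mu where mu: "is_partition mu" "part mu = strip_removal lam r" "length mu < length lam"
      using exists_partition_strip_removal[OF P row_of_strip_label[OF long r]] .
    have "admissible (beta_set n mu)"
      using admissible_strip_removal_iff[OF P pos r mu(2)] less.prems(2) by blast
    then obtain i tau where "mod_rule n mu i tau" using less.hyps mu unfolding i2n_finite_def by blast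
    moreover have "diagram mu = diagram lam - border_strip n lam"
      using diagram_minus_border_strip[OF P long r] mu(2) diagram_eq_diagram_fun
      by metis
    ultimately have "mod_rule n lam (num_columns (border_strip n lam) + i) tau"
      using border_strip_exists_if_strip_label[OF P long r] long pos mu(1)
      by (blast intro: mod_rule.step)
    then show ?thesis unfolding i2n_finite_def by blast
  qed
qed

lemma i2n_finite_iff_admissible:
  "is_partition lam \<Longrightarrow> i2n_finite n lam \<longleftrightarrow> admissible (beta_set n lam)"
  using mod_rule_imp_admissible admissible_imp_i2n_finite unfolding i2n_finite_def by blast

section \<open>Partitions in a box and their beta numbers\<close>

lemma admissible_length_bound:
  assumes P: "is_partition lam" and k: "part lam 0 \<le> k" and adm: "admissible (beta_set n lam)"
  shows "length lam \<le> 2 * n + k + 1"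
proof (rule ccontr)
  assume long: "\<not> ?thesis"
  have "0 < strip_label n lam" using long by simp
  then have "strip_label n lam \<in> beta_set n lam"
    using adm neg_strip_label_notin_beta_set[OF P] unfolding admissible_def by blast
  then obtain i where i: "int (part lam i) - int i + int n = strip_label n lam"
    unfolding beta_set_def beta_def by auto
  have "part lam i \<le> k" using part_antimono[OF P, of 0 i] k by simp
  with i long show False by linarith
qed

definition beta_numbers :: "nat \<Rightarrow> nat list \<Rightarrow> nat set" where
  "beta_numbers L lam = (\<lambda>i. part lam i + (L - 1 - i)) ` {0..<L}"

definition admissible_at :: "nat \<Rightarrow> nat set \<Rightarrow> bool" where
  "admissible_at N B \<longleftrightarrow> N \<in> B \<and> (\<forall>y\<in>{1..N}. N + y \<in> B \<or> N - y \<in> B)"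

lemma mem_beta_set_iff_mem_beta_numbers:
  assumes "length lam \<le> N + n + 1"
  shows "int z - int N \<in> beta_set n lam \<longleftrightarrow> z \<in> beta_numbers (N + n + 1) lam"
proof
  assume "int z - int N \<in> beta_set n lam"
  then obtain i where i: "int (part lam i) - int i + int n = int z - int N"
    unfolding beta_set_def beta_def by auto
  have "i < N + n + 1"
  proof (rule ccontr)
    assume "\<not> i < N + n + 1"
    with assms have "part lam i = 0" by (simp add: part_def)
    with i \<open>\<not> i < N + n + 1\<close> show False by linarith
  qed
  moreover from this i have "z = part lam i + (N + n + 1 - 1 - i)" by linarith
  ultimately show "z \<in> beta_numbers (N + n + 1) lam" unfolding beta_numbers_def by auto
next
  assume "z \<in> beta_numbers (N + n + 1) lam"
  then obtain i where "i < N + n + 1" "z = part lam i + (N + n + 1 - 1 - i)"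
    unfolding beta_numbers_def by auto
  then have "beta n (part lam) i = int z - int N" unfolding beta_def by linarith
  then show "int z - int N \<in> beta_set n lam" unfolding beta_set_def by (metis rangeI)
qed

lemma beta_set_contains_below:
  assumes "length lam \<le> N + n + 1" "y < - int N"
  shows "y \<in> beta_set n lam"
proof -
  have "length lam \<le> nat (int n - y)" using assms by linarith
  then have "part lam (nat (int n - y)) = 0" by (simp add: part_def)
  then have "beta n (part lam) (nat (int n - y)) = y" using assms(2) by (simp add: beta_def)
  then show ?thesis unfolding beta_set_def by (metis rangeI)
qed

lemma admissible_iff_admissible_at:
  assumes "length lam \<le> N + n + 1"
  shows "admissible (beta_set n lam) \<longleftrightarrow> admissible_at N (beta_numbers (N + n + 1) lam)"
proof -
  note mem = mem_beta_set_iff_mem_beta_numbers[OF assms]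
  have up: "int y \<in> beta_set n lam \<longleftrightarrow> N + y \<in> beta_numbers (N + n + 1) lam" for y
    using mem[of "N + y"] by simp
  have down: "- int y \<in> beta_set n lam \<longleftrightarrow> N - y \<in> beta_numbers (N + n + 1) lam" if "y \<le> N" for y
    using mem[of "N - y"] that by (simp add: of_nat_diff)
  have "(\<forall>y>0. y \<in> beta_set n lam \<or> - y \<in> beta_set n lam) \<longleftrightarrow>
      (\<forall>y\<in>{1..N}. N + y \<in> beta_numbers (N + n + 1) lam \<or> N - y \<in> beta_numbers (N + n + 1) lam)"
  proof
    assume "\<forall>y>0. y \<in> beta_set n lam \<or> - y \<in> beta_set n lam"
    then show "\<forall>y\<in>{1..N}. N + y \<in> beta_numbers (N + n + 1) lam \<or> N - y \<in> beta_numbers (N + n + 1) lam"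
      using up down by (metis atLeastAtMost_iff of_nat_0_less_iff less_le_trans zero_less_one)
  next
    assume H: "\<forall>y\<in>{1..N}. N + y \<in> beta_numbers (N + n + 1) lam \<or> N - y \<in> beta_numbers (N + n + 1) lam"
    show "\<forall>y>0. y \<in> beta_set n lam \<or> - y \<in> beta_set n lam"
    proof (intro allI impI)
      fix y :: int assume "0 < y"
      show "y \<in> beta_set n lam \<or> - y \<in> beta_set n lam"
      proof (cases "y \<le> int N")
        case True
        with \<open>0 < y\<close> have "nat y \<in> {1..N}" by auto
        with H have "N + nat y \<in> beta_numbers (N + n + 1) lam \<or> N - nat y \<in> beta_numbers (N + n + 1) lam"
          by blast
        with True \<open>0 < y\<close> show ?thesis using up[of "nat y"] down[of "nat y"] by auto
      qed (use beta_set_contains_below[OF assms, of "- y"] in simp)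
    qed
  qed
  moreover have "0 \<in> beta_set n lam \<longleftrightarrow> N \<in> beta_numbers (N + n + 1) lam" using mem[of N] by simp
  ultimately show ?thesis unfolding admissible_def admissible_at_def by blast
qed

lemma beta_number_strict_antimono:
  assumes P: "is_partition lam" and "i < j" "j < L"
  shows "part lam j + (L - 1 - j) < part lam i + (L - 1 - i)"
  using part_antimono[OF P, of i j] assms(2,3) by simp

lemma finite_beta_numbers: "finite (beta_numbers L lam)"
  by (simp add: beta_numbers_def)

lemma card_beta_numbers:
  assumes P: "is_partition lam"
  shows "card (beta_numbers L lam) = L"
proof -
  have "inj_on (\<lambda>i. part lam i + (L - 1 - i)) {0..<L}"
    by (rule inj_onI) (metis atLeastLessThan_iff beta_number_strict_antimono[OF P] less_irrefl nat_neq_iff)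
  then have "card ((\<lambda>i. part lam i + (L - 1 - i)) ` {0..<L}) = card {0..<L}" by (rule card_image)
  then show ?thesis unfolding beta_numbers_def by simp
qed

lemma rev_sorted_list_of_beta_numbers:
  assumes P: "is_partition lam"
  shows "rev (sorted_list_of_set (beta_numbers L lam)) = map (\<lambda>i. part lam i + (L - 1 - i)) [0..<L]"
proof -
  define g where "g i = part lam i + (L - 1 - i)" for i
  have "sorted_wrt (\<lambda>x y. y < x) (map g [0..<L])"
    using beta_number_strict_antimono[OF P] by (auto simp: sorted_wrt_iff_nth_less g_def)
  then have "sorted_wrt (<) (rev (map g [0..<L]))" by (simp add: sorted_wrt_rev)
  moreover have "set (rev (map g [0..<L])) = beta_numbers L lam" by (simp add: beta_numbers_def g_def)
  moreover have "length (rev (map g [0..<L])) = card (beta_numbers L lam)"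
    by (simp add: card_beta_numbers[OF P])
  ultimately have "sorted_list_of_set (beta_numbers L lam) = rev (map g [0..<L])"
    using sorted_list_of_set_unique[OF finite_beta_numbers] by blast
  then show ?thesis by (simp add: g_def)
qed

lemma beta_numbers_subset:
  assumes P: "is_partition lam" and k: "part lam 0 \<le> k"
  shows "beta_numbers L lam \<subseteq> {0..k + L - 1}"
proof
  fix z assume "z \<in> beta_numbers L lam"
  then obtain i where "i < L" "z = part lam i + (L - 1 - i)" unfolding beta_numbers_def by auto
  moreover have "part lam i \<le> k" using part_antimono[OF P, of 0 i] k by simp
  ultimately show "z \<in> {0..k + L - 1}" by simp
qed

definition part_of_beta_numbers :: "nat \<Rightarrow> nat set \<Rightarrow> nat \<Rightarrow> nat" where
  "part_of_beta_numbers L B i = (if i < L then rev (sorted_list_of_set B) ! i - (L - 1 - i) else 0)"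

definition partition_of_beta_numbers :: "nat \<Rightarrow> nat set \<Rightarrow> nat list" where
  "partition_of_beta_numbers L B = partition_of_fun (part_of_beta_numbers L B)"

lemma strict_sorted_nth_gap:
  assumes "sorted_wrt (<) (xs :: nat list)" "i \<le> j" "j < length xs"
  shows "xs ! i + (j - i) \<le> xs ! j"
  using assms(2,3)
proof (induction j)
  case (Suc j)
  show ?case
  proof (cases "i = Suc j")
    case False
    then have "xs ! i + (j - i) \<le> xs ! j" using Suc by simp
    moreover have "xs ! j < xs ! Suc j" using assms(1) Suc.prems by (simp add: sorted_wrt_iff_nth_less)
    ultimately show ?thesis using False Suc.prems by simp
  qed simp
qed simp

lemma part_of_beta_numbers:
  assumes "finite B" "card B = L"
  shows "\<And>i j. i \<le> j \<Longrightarrow> part_of_beta_numbers L B j \<le> part_of_beta_numbers L B i"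
    and "part_of_beta_numbers L B L = 0"
    and "\<And>i. i < L \<Longrightarrow> part_of_beta_numbers L B i + (L - 1 - i) = rev (sorted_list_of_set B) ! i"
proof -
  define xs where "xs = sorted_list_of_set B"
  have len: "length xs = L" and sorted: "sorted_wrt (<) xs"
    using assms unfolding xs_def by auto
  have rev: "rev xs ! i = xs ! (L - 1 - i)" if "i < L" for i using len that by (simp add: rev_nth)
  show "part_of_beta_numbers L B L = 0" by (simp add: part_of_beta_numbers_def)
  show "part_of_beta_numbers L B i + (L - 1 - i) = rev (sorted_list_of_set B) ! i" if "i < L" for i
    using strict_sorted_nth_gap[OF sorted, of 0 "L - 1 - i"] len rev[OF that] that
    unfolding part_of_beta_numbers_def xs_def[symmetric] by simp
  show "part_of_beta_numbers L B j \<le> part_of_beta_numbers L B i" if "i \<le> j" for i j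
  proof (cases "j < L")
    case True
    then have "xs ! (L - 1 - j) + ((L - 1 - i) - (L - 1 - j)) \<le> xs ! (L - 1 - i)"
      using strict_sorted_nth_gap[OF sorted, of "L - 1 - j" "L - 1 - i"] that len by simp
    with True that rev show ?thesis unfolding part_of_beta_numbers_def xs_def[symmetric] by simp
  qed (simp add: part_of_beta_numbers_def)
qed

lemma partition_of_beta_numbers:
  assumes "finite B" "card B = L"
  shows "is_partition (partition_of_beta_numbers L B)"
    and "part (partition_of_beta_numbers L B) = part_of_beta_numbers L B"
    and "length (partition_of_beta_numbers L B) \<le> L"
    and "beta_numbers L (partition_of_beta_numbers L B) = B"
proof -
  note f = part_of_beta_numbers[OF assms]
  show "is_partition (partition_of_beta_numbers L B)"
    and part: "part (partition_of_beta_numbers L B) = part_of_beta_numbers L B"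
    and "length (partition_of_beta_numbers L B) \<le> L"
    unfolding partition_of_beta_numbers_def
    using partition_of_fun[of "part_of_beta_numbers L B" L, OF f(1,2)] by auto
  have "beta_numbers L (partition_of_beta_numbers L B) = (\<lambda>i. rev (sorted_list_of_set B) ! i) ` {0..<L}"
    unfolding beta_numbers_def part using f(3) by (auto intro!: image_cong)
  also have "\<dots> = set (rev (sorted_list_of_set B))"
    using assms by (auto simp: set_conv_nth)
  also have "\<dots> = B" using assms by simp
  finally show "beta_numbers L (partition_of_beta_numbers L B) = B" .
qed

lemma partition_of_beta_numbers_beta_numbers:
  assumes P: "is_partition lam" and len: "length lam \<le> L"
  shows "partition_of_beta_numbers L (beta_numbers L lam) = lam"
proof -
  have "part_of_beta_numbers L (beta_numbers L lam) i = part lam i" for i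
    using len rev_sorted_list_of_beta_numbers[OF P, of L]
    by (cases "i < L") (simp_all add: part_of_beta_numbers_def part_def)
  then show ?thesis
    using partition_of_beta_numbers[OF finite_beta_numbers card_beta_numbers[OF P]] P part_inj
    by (metis ext)
qed

lemma part_of_beta_numbers_0_le:
  assumes B: "B \<subseteq> {0..k + L - 1}" and card: "card B = L"
  shows "part_of_beta_numbers L B 0 \<le> k"
proof (cases "L = 0")
  case False
  have fin: "finite B" using B finite_subset by blast
  have "rev (sorted_list_of_set B) ! 0 \<in> B"
    using fin card False by (metis length_rev length_sorted_list_of_set nth_mem gr0I set_rev
        sorted_list_of_set.set_sorted_key_list_of_set)
  with B False part_of_beta_numbers(3)[OF fin card, of 0] show ?thesis by auto
qed (simp add: part_of_beta_numbers_def)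

lemma bij_betw_beta_numbers:
  "bij_betw (beta_numbers L)
     {lam. is_partition lam \<and> part lam 0 \<le> k \<and> length lam \<le> L}
     {B. B \<subseteq> {0..k + L - 1} \<and> card B = L}"
proof (rule bij_betw_byWitness[where f' = "partition_of_beta_numbers L"])
  show "\<forall>lam\<in>{lam. is_partition lam \<and> part lam 0 \<le> k \<and> length lam \<le> L}.
      partition_of_beta_numbers L (beta_numbers L lam) = lam"
    using partition_of_beta_numbers_beta_numbers by blast
  show "\<forall>B\<in>{B. B \<subseteq> {0..k + L - 1} \<and> card B = L}. beta_numbers L (partition_of_beta_numbers L B) = B"
    using partition_of_beta_numbers(4) finite_subset by blast
  show "beta_numbers L ` {lam. is_partition lam \<and> part lam 0 \<le> k \<and> length lam \<le> L}
      \<subseteq> {B. B \<subseteq> {0..k + L - 1} \<and> card B = L}"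
    using beta_numbers_subset card_beta_numbers by blast
  show "partition_of_beta_numbers L ` {B. B \<subseteq> {0..k + L - 1} \<and> card B = L}
      \<subseteq> {lam. is_partition lam \<and> part lam 0 \<le> k \<and> length lam \<le> L}"
    using partition_of_beta_numbers finite_subset part_of_beta_numbers_0_le
    by (smt (verit) image_subset_iff finite_atLeastAtMost mem_Collect_eq)
qed

section \<open>Counting admissible sets of beta numbers\<close>

definition centred_set :: "nat \<Rightarrow> nat set \<Rightarrow> nat set \<Rightarrow> nat set" where
  "centred_set N D E = insert N ((\<lambda>y. N + y) ` (D \<union> E) \<union> (\<lambda>y. N - y) ` ({1..N} - E))"

definition centred_code :: "nat \<Rightarrow> nat set \<Rightarrow> nat set \<times> nat set" where
  "centred_code N B = ({y\<in>{1..N}. N + y \<in> B \<and> N - y \<in> B}, {y\<in>{1..N}. N + y \<in> B \<and> N - y \<notin> B})"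

lemma add_mem_centred_set_iff: "1 \<le> y \<Longrightarrow> N + y \<in> centred_set N D E \<longleftrightarrow> y \<in> D \<union> E"
  unfolding centred_set_def by auto

lemma diff_mem_centred_set_iff: "y \<in> {1..N} \<Longrightarrow> N - y \<in> centred_set N D E \<longleftrightarrow> y \<notin> E"
proof -
  assume y: "y \<in> {1..N}"
  have "inj_on (\<lambda>y. N - y) {1..N}" by (auto simp: inj_on_def)
  then have "N - y \<in> (\<lambda>y. N - y) ` ({1..N} - E) \<longleftrightarrow> y \<in> {1..N} - E"
    by (rule inj_on_image_mem_iff) (use y in auto)
  moreover have "N - y \<noteq> N" "\<And>z. N - y \<noteq> N + z" using y by auto
  ultimately show ?thesis unfolding centred_set_def using y by auto
qed

lemma centred_set_subset: "D \<subseteq> {1..N} \<Longrightarrow> E \<subseteq> {1..N} \<Longrightarrow> centred_set N D E \<subseteq> {0..2 * N}"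
  unfolding centred_set_def by auto

lemma admissible_at_centred_set: "admissible_at N (centred_set N D E)"
  unfolding admissible_at_def
  using add_mem_centred_set_iff[of _ N D E] diff_mem_centred_set_iff[of _ N D E]
  by (auto simp: centred_set_def)

lemma card_centred_set:
  assumes D: "D \<subseteq> {1..N}" and E: "E \<subseteq> {1..N}" and disj: "D \<inter> E = {}"
  shows "card (centred_set N D E) = N + card D + 1"
proof -
  define A where "A = (\<lambda>y. N + y) ` (D \<union> E)"
  define C where "C = (\<lambda>y. N - y) ` ({1..N} - E)"
  have fin: "finite D" "finite E" using D E finite_subset by blast+
  have "card A = card D + card E"
    unfolding A_def using card_Un_disjoint[OF fin disj] by (simp add: card_image)
  moreover have "inj_on (\<lambda>y. N - y) ({1..N} - E)" by (auto simp: inj_on_def)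
  then have "card C = N - card E"
    unfolding C_def using card_image card_Diff_subset[OF fin(2) E] by fastforce
  moreover have "card E \<le> N" using card_mono[OF _ E] by simp
  moreover have "card (centred_set N D E) = Suc (card A + card C)"
  proof -
    have "A \<inter> C = {}" "N \<notin> A \<union> C" unfolding A_def C_def using D E by auto
    moreover have "finite A" "finite C" unfolding A_def C_def using fin by auto
    ultimately show ?thesis unfolding centred_set_def A_def[symmetric] C_def[symmetric]
      by (simp add: card_Un_disjoint)
  qed
  ultimately show ?thesis by simp
qed

lemma centred_set_centred_code:
  assumes B: "B \<subseteq> {0..2 * N}" and adm: "admissible_at N B"
  shows "case_prod (centred_set N) (centred_code N B) = B"
proof -
  obtain D E where DE: "centred_code N B = (D, E)" by fastforce
  have "z \<in> centred_set N D E \<longleftrightarrow> z \<in> B" for z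
  proof (cases z N rule: linorder_cases)
    case less
    then obtain y where z: "z = N - y" "y \<in> {1..N}" by (metis atLeastAtMost_iff diff_diff_cancel
        diff_le_self less_imp_le_nat zero_less_diff Suc_leI One_nat_def)
    have "y \<notin> E \<longleftrightarrow> z \<in> B" using DE adm z unfolding centred_code_def admissible_at_def by auto
    with diff_mem_centred_set_iff[OF z(2)] z(1) show ?thesis by simp
  next
    case equal
    with adm show ?thesis unfolding centred_set_def admissible_at_def by simp
  next
    case greater
    then obtain y where z: "z = N + y" "1 \<le> y" by (metis le_add_diff_inverse less_imp_le_nat
        zero_less_diff Suc_leI One_nat_def)
    show ?thesis
    proof (cases "y \<le> N")
      case True
      have "y \<in> D \<union> E \<longleftrightarrow> z \<in> B" using DE True z unfolding centred_code_def by auto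
      with add_mem_centred_set_iff[OF z(2)] z(1) show ?thesis by simp
    next
      case False
      with B z DE show ?thesis unfolding centred_set_def centred_code_def by auto
    qed
  qed
  with DE show ?thesis by auto
qed

lemma centred_code_centred_set:
  assumes D: "D \<subseteq> {1..N}" and E: "E \<subseteq> {1..N}" and disj: "D \<inter> E = {}"
  shows "centred_code N (centred_set N D E) = (D, E)"
proof -
  have "{y\<in>{1..N}. N + y \<in> centred_set N D E \<and> N - y \<in> centred_set N D E} = {y\<in>{1..N}. y \<in> D \<union> E \<and> y \<notin> E}"
    "{y\<in>{1..N}. N + y \<in> centred_set N D E \<and> N - y \<notin> centred_set N D E} = {y\<in>{1..N}. y \<in> D \<union> E \<and> y \<in> E}"
    using add_mem_centred_set_iff[of _ N D E] diff_mem_centred_set_iff[of _ N D E] by auto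
  with D E disj show ?thesis unfolding centred_code_def by auto
qed

lemma card_admissible_at:
  "card {B. B \<subseteq> {0..2 * N} \<and> card B = N + n + 1 \<and> admissible_at N B} = (N choose n) * 2 ^ (N - n)"
proof -
  define T where "T = {B. B \<subseteq> {0..2 * N} \<and> card B = N + n + 1 \<and> admissible_at N B}"
  define \<Sigma> where "\<Sigma> = Sigma {D. D \<subseteq> {1..N} \<and> card D = n} (\<lambda>D. Pow ({1..N} - D))"
  have "bij_betw (centred_code N) T \<Sigma>"
  proof (rule bij_betw_byWitness[where f' = "case_prod (centred_set N)"])
    show "\<forall>B\<in>T. case_prod (centred_set N) (centred_code N B) = B"
      unfolding T_def using centred_set_centred_code by simp
    show "\<forall>DE\<in>\<Sigma>. centred_code N (case_prod (centred_set N) DE) = DE"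
    proof
      fix DE assume "DE \<in> \<Sigma>"
      then obtain D E where "DE = (D, E)" "D \<subseteq> {1..N}" "E \<subseteq> {1..N}" "D \<inter> E = {}"
        unfolding \<Sigma>_def by auto
      then show "centred_code N (case_prod (centred_set N) DE) = DE"
        using centred_code_centred_set by simp
    qed
    show "centred_code N ` T \<subseteq> \<Sigma>"
    proof
      fix DE assume "DE \<in> centred_code N ` T"
      then obtain B where B: "B \<in> T" "DE = centred_code N B" by auto
      obtain D E where DE: "centred_code N B = (D, E)" by (cases "centred_code N B")
      have sub: "D \<subseteq> {1..N}" "E \<subseteq> {1..N}" "D \<inter> E = {}"
        using DE unfolding centred_code_def by auto
      have "centred_set N D E = B" using centred_set_centred_code[of B N] B(1) DE unfolding T_def by simp
      with B(1) card_centred_set[OF sub] have "card D = n" unfolding T_def by simp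
      with B(2) DE sub show "DE \<in> \<Sigma>" unfolding \<Sigma>_def by auto
    qed
    show "case_prod (centred_set N) ` \<Sigma> \<subseteq> T"
    proof
      fix B assume "B \<in> case_prod (centred_set N) ` \<Sigma>"
      then obtain D E where "B = centred_set N D E" "D \<subseteq> {1..N}" "E \<subseteq> {1..N}" "D \<inter> E = {}" "card D = n"
        unfolding \<Sigma>_def by auto
      then show "B \<in> T"
        using card_centred_set centred_set_subset admissible_at_centred_set unfolding T_def by simp
    qed
  qed
  then have "card T = card \<Sigma>" by (rule bij_betw_same_card)
  also have "\<dots> = (\<Sum>D\<in>{D. D \<subseteq> {1..N} \<and> card D = n}. card (Pow ({1..N} - D)))"
    unfolding \<Sigma>_def by (rule card_SigmaI) auto
  also have "\<dots> = (\<Sum>D\<in>{D. D \<subseteq> {1..N} \<and> card D = n}. 2 ^ (N - n))"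
  proof (rule sum.cong)
    fix D assume "D \<in> {D. D \<subseteq> {1..N} \<and> card D = n}"
    then have "card ({1..N} - D) = N - n"
      using card_Diff_subset[of D "{1..N}"] finite_subset[of D "{1..N}"] by auto
    then show "card (Pow ({1..N} - D)) = 2 ^ (N - n)" by (simp add: card_Pow)
  qed simp
  also have "\<dots> = (N choose n) * 2 ^ (N - n)" using n_subsets[of "{1..N}" n] by simp
  finally show ?thesis unfolding T_def .
qed

theorem mainTheorem2:
  fixes n k :: nat
  shows "card {lam. is_partition lam \<and> largest_part lam \<le> k \<and> i2n_finite n lam}
           = 2 ^ k * ((n + k) choose k)"
proof -
  define N where "N = n + k"
  define L where "L = N + n + 1"
  let ?box = "{lam. is_partition lam \<and> part lam 0 \<le> k \<and> length lam \<le> L}"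
  have "is_partition lam \<and> largest_part lam \<le> k \<and> i2n_finite n lam \<longleftrightarrow>
      lam \<in> ?box \<and> admissible (beta_set n lam)" for lam
    using i2n_finite_iff_admissible largest_part_eq_part_0 admissible_length_bound[of lam k n]
    unfolding L_def N_def by auto
  then have "card {lam. is_partition lam \<and> largest_part lam \<le> k \<and> i2n_finite n lam} =
      card {lam \<in> ?box. admissible (beta_set n lam)}" by simp
  also have "\<dots> = card {B \<in> {B. B \<subseteq> {0..k + L - 1} \<and> card B = L}. admissible_at N B}"
  proof (rule bij_betw_same_card, rule bij_betw_Collect[OF bij_betw_beta_numbers])
    fix lam assume "lam \<in> ?box"
    then show "admissible_at N (beta_numbers L lam) \<longleftrightarrow> admissible (beta_set n lam)"
      using admissible_iff_admissible_at[of lam N n] unfolding L_def by simp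
  qed
  also have "\<dots> = card {B. B \<subseteq> {0..2 * N} \<and> card B = N + n + 1 \<and> admissible_at N B}"
  proof -
    have "k + L - 1 = 2 * N" unfolding L_def N_def by simp
    then show ?thesis unfolding L_def by (simp only: mem_Collect_eq conj_assoc)
  qed
  also have "\<dots> = (N choose n) * 2 ^ (N - n)" by (rule card_admissible_at)
  also have "\<dots> = 2 ^ k * ((n + k) choose k)"
    unfolding N_def using binomial_symmetric[of k "n + k"] by simp
  finally show ?thesis .
qed

end
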